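(* For integers $n\ge0$ and $r\in\mathbb{Z}$, the reproducing kernel $$K_n(z_2,z_1;r):=\sum_{j=0}^n\frac{1}{h^{(r)}_j}Q_j(z_2;r)P_j(z_1;r)$$ of the $2j-k$ system satisfies the Christoffel-Darboux identity $$K_n(z_2,z_1;r)=\frac{1}{z_2z_1^2-1}\Big\{\frac{1}{h^{(r+2)}_n}P_n(z_1;r+2)Q_{n+1}(z_2;r)+\frac{1}{h^{(r)}_n}z_2P_{n+2}(z_1;r+2)Q_n(z_2;r)$$ $$\qquad+\frac{1}{h^{(r+2)}_{n+1}}P_{n+1}(z_1;r+2)\Big[Q_{n+2}(z_2;r)-\big(z_2+q^{(r)}_{n+2,1}-q^{(r+2)}_{n+1,1}\big)Q_{n+1}(z_2;r)\Big]\Big\}$$ for all $z_1,z_2\in\mathbb{C}$ with $z_2z_1^2\ne1$.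
   Context: $w$ is a weight function on the unit circle $\mathbb{T}$ with moments $w_\ell=\int_{\mathbb{T}} w(\zeta)\zeta^{-\ell}\frac{d\zeta}{2\pi \mathrm{i}\zeta}$, $\ell\in\mathbb{Z}$. For $t\in\mathbb{Z}$, $D^{(t)}_k:=\det(w_{2i-l+t})_{0\le i,l\le k-1}$, $D_0^{(t)}:=1$, and $h^{(t)}_k:=D^{(t)}_{k+1}/D^{(t)}_k$. The monic polynomials $P_k(z;t)$, $Q_k(z;t)$ of degree $k$ (the $2j-k$ bi-orthogonal system with offset $t$) are determined by $$\int_{\mathbb{T}}P_k(\zeta;t)Q_l(\zeta^{-2};t)\zeta^{-t}w(\zeta)\frac{d\zeta}{2\pi \mathrm{i}\zeta}=h^{(t)}_k\delta_{kl}.$$ Explicitly, when $D_k^{(t)}\ne0$: $P_k(z;t)$ is $1/D_k^{(t)}$ times the determinant of the $(k+1)\times(k+1)$ matrix with rows $(w_{t+2i},w_{t+2i-1},\dots,w_{t+2i-k})$, $0\le i\le k-1$, and last row $(1,z,\dots,z^k)$; $Q_k(z;t)$ is $1/D_k^{(t)}$ times the determinant of the $(k+1)\times(k+1)$ matrix with rows $(w_{t+2i},w_{t+2i-1},\dots,w_{t+2i-k+1},z^i)$, $0\le i\le k$. Write $Q_k(z;t)=z^k+\sum_{\ell=1}^kq^{(t)}_{k,\ell}z^{k-\ell}$. Standing assumption: $D_k^{(t)}\neq0$ for $0\le k\le n+2$ and $t\in\{r,r+2\}$, so that all displayed polynomials and reciprocals of norms are defined. *)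

theory Defs
  imports
    "HOL-Complex_Analysis.Contour_Integration"
    "Jordan_Normal_Form.Determinant"
begin

definition circle_integral :: "(complex \<Rightarrow> complex) \<Rightarrow> complex" where
  "circle_integral f =
     contour_integral (circlepath 0 1) (\<lambda>\<zeta>. f \<zeta> / (2 * of_real pi * \<i> * \<zeta>))"

text \<open>
  No sign condition is imposed: a weight is any complex-valued function that is Lebesgue
  integrable over the unit circle. In particular every integral below exists.
\<close>

definition circle_weight :: "(complex \<Rightarrow> complex) \<Rightarrow> bool" where
  "circle_weight w \<longleftrightarrow> (\<lambda>\<theta>. w (cis \<theta>)) absolutely_integrable_on {0..2 * pi}"

definition moment :: "(complex \<Rightarrow> complex) \<Rightarrow> int \<Rightarrow> complex" where
  "moment w l = circle_integral (\<lambda>\<zeta>. w \<zeta> * \<zeta> powi (- l))"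

definition moment_det :: "(complex \<Rightarrow> complex) \<Rightarrow> int \<Rightarrow> nat \<Rightarrow> complex" where
  "moment_det w t k =
     Determinant.det (Matrix.mat k k (\<lambda>(i, l). moment w (2 * int i - int l + t)))"

definition norm_const :: "(complex \<Rightarrow> complex) \<Rightarrow> int \<Rightarrow> nat \<Rightarrow> complex" where
  "norm_const w t k = moment_det w t (Suc k) / moment_det w t k"

text \<open>
  The members of index at most \<open>N\<close> of the \<open>2j-k\<close> bi-orthogonal system with offset \<open>t\<close>.
  The truncation is needed because only finitely many of the determinants are assumed to be
  nonzero, so that the system need not exist beyond \<open>N\<close>.
\<close>

definition biorthogonal_upto ::
  "(complex \<Rightarrow> complex) \<Rightarrow> int \<Rightarrow> nat \<Rightarrow> (nat \<Rightarrow> complex poly) \<Rightarrow> (nat \<Rightarrow> complex poly) \<Rightarrow> bool"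
  where
  "biorthogonal_upto w t N P Q \<longleftrightarrow>
     (\<forall>k\<le>N. degree (P k) = k \<and> lead_coeff (P k) = 1 \<and>
            degree (Q k) = k \<and> lead_coeff (Q k) = 1) \<and>
     (\<forall>k\<le>N. \<forall>l\<le>N.
        circle_integral
          (\<lambda>\<zeta>. poly (P k) \<zeta> * poly (Q l) (\<zeta> powi (- 2)) * \<zeta> powi (- t) * w \<zeta>) =
        (if k = l then norm_const w t k else 0))"

text \<open>For \<open>p\<close> monic of degree \<open>k\<close>: \<open>p = z^k + (\<Sum>l=1..k. subcoeff p l * z^(k - l))\<close>.\<close>

definition subcoeff :: "complex poly \<Rightarrow> nat \<Rightarrow> complex" where
  "subcoeff p l = coeff p (degree p - l)"

definition reproducing_kernel ::
  "(complex \<Rightarrow> complex) \<Rightarrow> int \<Rightarrow> (nat \<Rightarrow> complex poly) \<Rightarrow> (nat \<Rightarrow> complex poly) \<Rightarrow>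
   nat \<Rightarrow> complex \<Rightarrow> complex \<Rightarrow> complex"
  where
  "reproducing_kernel w t P Q n z2 z1 =
     (\<Sum>j=0..n. 1 / norm_const w t j * poly (Q j) z2 * poly (P j) z1)"

text \<open>
  Since \<open>biorthogonal_upto\<close> is a predicate on families of polynomials, the following
  determinantal formulas serve to show that it is satisfied whenever the moment determinants
  up to index \<open>N\<close> do not vanish (\<open>biorthogonal_upto_det\<close> below).
\<close>

definition det_P :: "(complex \<Rightarrow> complex) \<Rightarrow> int \<Rightarrow> nat \<Rightarrow> complex poly" where
  "det_P w t k = Polynomial.smult (1 / moment_det w t k)
     (Determinant.det (Matrix.mat (Suc k) (Suc k)
        (\<lambda>(i, l). if i < k then [:moment w (t + 2 * int i - int l):] else monom 1 l)))"

definition det_Q :: "(complex \<Rightarrow> complex) \<Rightarrow> int \<Rightarrow> nat \<Rightarrow> complex poly" where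
  "det_Q w t k = Polynomial.smult (1 / moment_det w t k)
     (Determinant.det (Matrix.mat (Suc k) (Suc k)
        (\<lambda>(i, l). if l < k then [:moment w (t + 2 * int i - int l):] else monom 1 i)))"

lemma moment_det_0 [simp]: "moment_det w t 0 = 1"
  by (simp add: moment_det_def)

lemma circle_integral_altdef:
  "circle_integral f = integral {0..2 * pi} (\<lambda>\<theta>. f (cis \<theta>)) / (2 * of_real pi)"
proof -
  have "circle_integral f =
      integral {0..2 * pi} (\<lambda>\<theta>. f (cis \<theta>) / (2 * of_real pi * \<i> * cis \<theta>) * \<i> * cis \<theta>)"
    unfolding circle_integral_def circlepath_def
    by (subst contour_integral_part_circlepath_eq) auto
  also have "\<dots> = integral {0..2 * pi} (\<lambda>\<theta>. f (cis \<theta>) / (2 * of_real pi))"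
    by (rule arg_cong[where f = "integral _"]) (auto simp: field_simps)
  finally show ?thesis
    by simp
qed

lemma circle_weight_times_powi:
  assumes "circle_weight w"
  shows "(\<lambda>\<theta>. cis \<theta> powi m * w (cis \<theta>)) integrable_on {0..2 * pi}"
proof -
  have cont: "continuous_on {0..2 * pi} (\<lambda>\<theta>. cis \<theta> powi m)"
    by (intro continuous_intros) auto
  have "(\<lambda>\<theta>. cis \<theta> powi m * w (cis \<theta>)) absolutely_integrable_on {0..2 * pi}"
  proof (rule absolutely_integrable_bounded_measurable_product[OF bilinear_times])
    show "(\<lambda>\<theta>. cis \<theta> powi m) \<in> borel_measurable (lebesgue_on {0..2 * pi})"
      using cont by (rule continuous_imp_measurable_on_sets_lebesgue) auto
    show "bounded ((\<lambda>\<theta>. cis \<theta> powi m) ` {0..2 * pi})"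
      using cont by (intro compact_imp_bounded compact_continuous_image) auto
  qed (use assms in \<open>auto simp: circle_weight_def\<close>)
  then show ?thesis
    by (simp add: absolutely_integrable_on_def)
qed

lemma circle_integral_poly:
  assumes "circle_weight w" "degree p \<le> m" "degree q \<le> n"
  shows "circle_integral (\<lambda>\<zeta>. poly p \<zeta> * poly q (\<zeta> powi (- 2)) * \<zeta> powi (- t) * w \<zeta>) =
    (\<Sum>j\<le>m. \<Sum>i\<le>n. coeff p j * coeff q i * moment w (t + 2 * int i - int j))"
proof -
  have altpoly: "poly r x = (\<Sum>i\<le>d. coeff r i * x ^ i)" if "degree r \<le> d" for r d and x :: complex
    using that unfolding poly_altdef
    by (intro sum.mono_neutral_left) (auto simp: coeff_eq_0)
  have pow: "cis \<theta> ^ j * (cis \<theta> powi (- 2)) ^ i * cis \<theta> powi (- t) =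
      cis \<theta> powi (- (t + 2 * int i - int j))" for \<theta> j i
  proof -
    have "cis \<theta> ^ j * (cis \<theta> powi (- 2)) ^ i * cis \<theta> powi (- t) =
        cis (real j * \<theta> + real i * (of_int (- 2) * \<theta>) + of_int (- t) * \<theta>)"
      unfolding cis_power_int Complex.DeMoivre cis_mult ..
    also have "\<dots> = cis (of_int (- (t + 2 * int i - int j)) * \<theta>)"
      by (rule arg_cong[where f = cis]) (simp add: algebra_simps)
    finally show ?thesis
      by (simp only: cis_power_int)
  qed
  have "circle_integral (\<lambda>\<zeta>. poly p \<zeta> * poly q (\<zeta> powi (- 2)) * \<zeta> powi (- t) * w \<zeta>) =
      integral {0..2 * pi} (\<lambda>\<theta>. \<Sum>j\<le>m. \<Sum>i\<le>n. coeff p j * coeff q i *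
        (cis \<theta> powi (- (t + 2 * int i - int j)) * w (cis \<theta>))) / (2 * of_real pi)"
    unfolding circle_integral_altdef altpoly[OF assms(2)] altpoly[OF assms(3)]
    unfolding pow[symmetric]
    by (simp add: sum_distrib_left sum_distrib_right mult_ac) (subst sum.swap, rule refl)
  also have "integral {0..2 * pi} (\<lambda>\<theta>. \<Sum>j\<le>m. \<Sum>i\<le>n. coeff p j * coeff q i *
        (cis \<theta> powi (- (t + 2 * int i - int j)) * w (cis \<theta>))) =
      (\<Sum>j\<le>m. \<Sum>i\<le>n. coeff p j * coeff q i * integral {0..2 * pi}
        (\<lambda>\<theta>. cis \<theta> powi (- (t + 2 * int i - int j)) * w (cis \<theta>)))"
    by (intro integral_unique has_integral_sum has_integral_mult_right integrable_integral
        circle_weight_times_powi assms finite_atMost)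
  also have "\<dots> / (2 * of_real pi) =
      (\<Sum>j\<le>m. \<Sum>i\<le>n. coeff p j * coeff q i * moment w (t + 2 * int i - int j))"
    by (simp only: moment_def circle_integral_altdef sum_divide_distrib times_divide_eq_right
        mult.commute[of "w _"])
  finally show ?thesis .
qed


lemma det_last_row:
  fixes a :: "nat \<Rightarrow> nat \<Rightarrow> complex"
  obtains c where
    "Determinant.det (Matrix.mat (Suc k) (Suc k)
        (\<lambda>(i, l). if i < k then [:a i l:] else monom 1 l)) = (\<Sum>l\<le>k. monom (c l) l)"
    and "\<And>v. Determinant.det (Matrix.mat (Suc k) (Suc k)
        (\<lambda>(i, l). if i < k then a i l else v l)) = (\<Sum>l\<le>k. c l * v l)"
    and "c k = Determinant.det (Matrix.mat k k (\<lambda>(i, l). a i l))"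
proof
  define M where "M l = Matrix.mat k k (\<lambda>(i, j). a i (if j < l then j else Suc j))" for l
  define c where "c l = (- 1) ^ (k + l) * Determinant.det (M l)" for l
  interpret lift: comm_ring_hom "\<lambda>x :: complex. [:x:]"
    by unfold_locales (auto simp: one_pCons)
  let ?A = "Matrix.mat (Suc k) (Suc k) (\<lambda>(i, l). if i < k then [:a i l:] else monom 1 l)"
  have "Determinant.det ?A = (\<Sum>l<Suc k. ?A $$ (k, l) * Determinant.cofactor ?A k l)"
    by (rule Determinant.laplace_expansion_row) auto
  also have "\<dots> = (\<Sum>l<Suc k. monom (c l) l)"
  proof (rule sum.cong[OF refl])
    fix l assume l: "l \<in> {..<Suc k}"
    have "mat_delete ?A k l = map_mat (\<lambda>x. [:x:]) (M l)"
      using l by (intro eq_matI) (auto simp: mat_delete_def M_def)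
    then have "Determinant.cofactor ?A k l = [:c l:]"
      by (simp add: Determinant.cofactor_def c_def lift.hom_det lift.hom_mult lift.hom_power
          lift.hom_uminus flip: one_pCons)
    then show "?A $$ (k, l) * Determinant.cofactor ?A k l = monom (c l) l"
      using l by (simp add: smult_monom mult.commute)
  qed
  finally show "Determinant.det ?A = (\<Sum>l\<le>k. monom (c l) l)"
    by (simp add: lessThan_Suc_atMost)
  show "Determinant.det (Matrix.mat (Suc k) (Suc k)
        (\<lambda>(i, l). if i < k then a i l else v l)) = (\<Sum>l\<le>k. c l * v l)" for v
  proof -
    let ?B = "Matrix.mat (Suc k) (Suc k) (\<lambda>(i, l). if i < k then a i l else v l)"
    have "Determinant.det ?B = (\<Sum>l<Suc k. ?B $$ (k, l) * Determinant.cofactor ?B k l)"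
      by (rule Determinant.laplace_expansion_row) auto
    also have "\<dots> = (\<Sum>l<Suc k. c l * v l)"
    proof (rule sum.cong[OF refl])
      fix l assume l: "l \<in> {..<Suc k}"
      have "mat_delete ?B k l = M l"
        using l by (intro eq_matI) (auto simp: mat_delete_def M_def)
      then show "?B $$ (k, l) * Determinant.cofactor ?B k l = c l * v l"
        using l by (simp add: Determinant.cofactor_def c_def)
    qed
    finally show ?thesis
      by (simp add: lessThan_Suc_atMost)
  qed
  have "M k = Matrix.mat k k (\<lambda>(i, l). a i l)"
    by (intro eq_matI) (auto simp: M_def)
  then show "c k = Determinant.det (Matrix.mat k k (\<lambda>(i, l). a i l))"
    by (simp add: c_def flip: mult_2)
qed

lemma det_poly:
  fixes a :: "nat \<Rightarrow> nat \<Rightarrow> complex"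
  defines "D \<equiv> \<lambda>k. Determinant.det (Matrix.mat k k (\<lambda>(i, l). a i l))"
  defines "p \<equiv> \<lambda>k. Polynomial.smult (1 / D k) (Determinant.det (Matrix.mat (Suc k) (Suc k)
        (\<lambda>(i, l). if i < k then [:a i l:] else monom 1 l)))"
  assumes "D k \<noteq> 0"
  shows "degree (p k) = k" "coeff (p k) k = 1"
    and "i \<le> k \<Longrightarrow> (\<Sum>l\<le>k. coeff (p k) l * a i l) = (if i = k then D (Suc k) / D k else 0)"
proof -
  obtain c where c:
    "Determinant.det (Matrix.mat (Suc k) (Suc k)
        (\<lambda>(i, l). if i < k then [:a i l:] else monom 1 l)) = (\<Sum>l\<le>k. monom (c l) l)"
    "\<And>v. Determinant.det (Matrix.mat (Suc k) (Suc k)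
        (\<lambda>(i, l). if i < k then a i l else v l)) = (\<Sum>l\<le>k. c l * v l)"
    "c k = D k"
    unfolding D_def by (rule det_last_row[of k a]) blast
  have coeff: "coeff (p k) l = (if l \<le> k then c l / D k else 0)" for l
    by (simp add: p_def c(1) coeff_sum)
  then show lead: "coeff (p k) k = 1"
    using assms(3) c(3) by simp
  show "degree (p k) = k"
    using coeff lead by (intro antisym degree_le le_degree) auto
  show "(\<Sum>l\<le>k. coeff (p k) l * a i l) = (if i = k then D (Suc k) / D k else 0)" if "i \<le> k"
  proof -
    let ?B = "Matrix.mat (Suc k) (Suc k) (\<lambda>(i', l). if i' < k then a i' l else a i l)"
    have "(\<Sum>l\<le>k. coeff (p k) l * a i l) = Determinant.det ?B / D k"
      by (simp add: coeff c(2) sum_divide_distrib)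
    also have "Determinant.det ?B = (if i = k then D (Suc k) else 0)"
    proof (cases "i = k")
      case True
      then have "?B = Matrix.mat (Suc k) (Suc k) (\<lambda>(i, l). a i l)"
        by (intro eq_matI) (auto simp: less_Suc_eq)
      with True show ?thesis
        by (simp add: D_def)
    next
      case False
      have "Determinant.det ?B = 0"
        by (rule Determinant.det_identical_rows[of _ "Suc k" i k])
          (use False that in \<open>auto intro!: eq_vecI\<close>)
      with False show ?thesis
        by simp
    qed
    finally show ?thesis
      by simp
  qed
qed

lemma moment_det_eqs:
  "moment_det w t k =
     Determinant.det (Matrix.mat k k (\<lambda>(i, l). moment w (t + 2 * int i - int l)))"
  "moment_det w t k =
     Determinant.det (Matrix.mat k k (\<lambda>(l, i). moment w (t + 2 * int i - int l)))"
proof -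
  show *: "moment_det w t k =
     Determinant.det (Matrix.mat k k (\<lambda>(i, l). moment w (t + 2 * int i - int l)))"
    by (simp add: moment_det_def algebra_simps)
  have "Matrix.mat k k (\<lambda>(l, i). moment w (t + 2 * int i - int l)) =
      transpose_mat (Matrix.mat k k (\<lambda>(i, l). moment w (t + 2 * int i - int l)))"
    by (intro eq_matI) auto
  then show "moment_det w t k =
     Determinant.det (Matrix.mat k k (\<lambda>(l, i). moment w (t + 2 * int i - int l)))"
    by (simp add: * Determinant.det_transpose[of _ k])
qed

lemma det_Q_transpose:
  "det_Q w t k = Polynomial.smult (1 / moment_det w t k)
     (Determinant.det (Matrix.mat (Suc k) (Suc k)
        (\<lambda>(l, i). if l < k then [:moment w (t + 2 * int i - int l):] else monom 1 i)))"
proof -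
  have "Matrix.mat (Suc k) (Suc k)
        (\<lambda>(l, i). if l < k then [:moment w (t + 2 * int i - int l):] else monom 1 i) =
      transpose_mat (Matrix.mat (Suc k) (Suc k)
        (\<lambda>(i, l). if l < k then [:moment w (t + 2 * int i - int l):] else monom 1 i))"
    by (intro eq_matI) auto
  then show ?thesis
    by (simp add: det_Q_def Determinant.det_transpose[of _ "Suc k"])
qed

lemma biorthogonal_upto_det:
  assumes "circle_weight w" and D: "\<And>k. k \<le> N \<Longrightarrow> moment_det w t k \<noteq> 0"
  shows "biorthogonal_upto w t N (det_P w t) (det_Q w t)"
proof -
  let ?m = "\<lambda>i l. moment w (t + 2 * int i - int l)"
  note P = det_poly[of k ?m for k, folded moment_det_eqs(1), folded det_P_def]
  note Q = det_poly[of k "\<lambda>l i. ?m i l" for k, folded moment_det_eqs(2), folded det_Q_transpose]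
  have "circle_integral (\<lambda>\<zeta>. poly (det_P w t k) \<zeta> * poly (det_Q w t l) (\<zeta> powi (- 2)) *
          \<zeta> powi (- t) * w \<zeta>) = (if k = l then norm_const w t k else 0)" (is "?I = ?R")
    if kl: "k \<le> N" "l \<le> N" for k l
  proof -
    have I: "?I = (\<Sum>j\<le>k. \<Sum>i\<le>l. coeff (det_P w t k) j * coeff (det_Q w t l) i * ?m i j)"
      by (rule circle_integral_poly) (simp_all add: assms(1) P(1)[OF D[OF kl(1)]] Q(1)[OF D[OF kl(2)]])
    show ?thesis
    proof (cases "l \<le> k")
      case True
      have "?I = (\<Sum>i\<le>l. coeff (det_Q w t l) i * (\<Sum>j\<le>k. coeff (det_P w t k) j * ?m i j))"
        unfolding I sum_distrib_left by (subst sum.swap) (simp add: mult_ac)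
      also have "\<dots> = (\<Sum>i\<le>l. if i = k then coeff (det_Q w t l) i * norm_const w t k else 0)"
        by (rule sum.cong[OF refl])
          (use P(3)[OF D[OF kl(1)]] True in \<open>auto simp: norm_const_def\<close>)
      also have "\<dots> = ?R"
        using True Q(2)[OF D[OF kl(2)]] by auto
      finally show ?thesis .
    next
      case False
      have "?I = (\<Sum>j\<le>k. coeff (det_P w t k) j * (\<Sum>i\<le>l. coeff (det_Q w t l) i * ?m i j))"
        unfolding I sum_distrib_left by (simp add: mult_ac)
      also have "\<dots> = 0"
        by (rule sum.neutral) (use Q(3)[OF D[OF kl(2)]] False in auto)
      finally show ?thesis
        using False by simp
    qed
  qed
  then show ?thesis
    using P(1,2) Q(1,2) D by (simp add: biorthogonal_upto_def)
qed

end

theory Submission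
  imports Defs
begin

text \<open>
  Integration against the weight turns pairs of polynomials into numbers through the bilinear form
  \<open>\<langle>p, q\<rangle>\<^sub>t = (\<Sum>j i. p\<^sub>j q\<^sub>i w\<^bsub>t + 2i - j\<^esub>)\<close>, for which \<open>P\<close> and \<open>Q\<close> are dual bases up to the norms. The index
  \<open>t + 2i - j\<close> gives two shift rules, \<open>\<langle>p, z q\<rangle>\<^sub>t = \<langle>p, q\<rangle>\<^bsub>t+2\<^esub>\<close> and
  \<open>\<langle>z\<^sup>2 p, q\<rangle>\<^bsub>t+2\<^esub> = \<langle>p, q\<rangle>\<^sub>t\<close>, which link the offsets \<open>r\<close> and \<open>r + 2\<close>.

  Fix \<open>y = z\<^sub>2\<close> and regard \<open>K = K\<^sub>n(y, \<cdot>; r)\<close> as a polynomial of degree at most \<open>n\<close>. It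
  satisfies \<open>\<langle>K, q\<rangle>\<^sub>r = q(y)\<close> for \<open>q\<close> of degree at most \<open>n\<close>, together with
  \<open>\<langle>K, Q\<^sub>l(r)\<rangle>\<^sub>r = 0\<close> for \<open>l > n\<close>. The polynomial \<open>F = (y z\<^sup>2 - 1) K\<close> has degree at most \<open>n + 2\<close>, so it is
  a combination of \<open>P\<^sub>k(r+2)\<close> with \<open>k \<le> n + 2\<close>. By the shift rules
  \<open>\<langle>F, q\<rangle>\<^bsub>r+2\<^esub> = y \<langle>K, q\<rangle>\<^sub>r - \<langle>K, z q\<rangle>\<^sub>r\<close>. If \<open>q\<close> has degree less than \<open>n\<close>, both terms are
  \<open>y q(y)\<close> and cancel, so only \<open>k = n, n + 1, n + 2\<close> contribute. The coefficient for \<open>k = n + 2\<close> is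
  the coefficient of \<open>z\<^bsup>n+2\<^esup>\<close> in \<open>F\<close>. The other two are found by taking \<open>q = Q\<^sub>k(r+2)\<close>, which is
  monic: \<open>q\<close> and \<open>z q\<close> are reduced modulo the \<open>Q\<^sub>l(r)\<close> with \<open>l > n\<close>, which \<open>K\<close> annihilates, to a
  polynomial of degree at most \<open>n\<close>, which \<open>K\<close> evaluates at \<open>y\<close>.
\<close>

section \<open>The moment form\<close>

definition moment_form ::
  "(complex \<Rightarrow> complex) \<Rightarrow> int \<Rightarrow> complex poly \<Rightarrow> complex poly \<Rightarrow> complex" where
  "moment_form w t p q =
     (\<Sum>j\<le>degree p. \<Sum>i\<le>degree q. coeff p j * coeff q i * moment w (t + 2 * int i - int j))"

text \<open>
  The summation ranges may be enlarged at will. This gives several polynomials a common range, so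
  that linearity and the shift rules become identities between finite sums.
\<close>

lemma moment_form_bounds:
  assumes "degree p \<le> m" "degree q \<le> n"
  shows "moment_form w t p q =
    (\<Sum>j\<le>m. \<Sum>i\<le>n. coeff p j * coeff q i * moment w (t + 2 * int i - int j))"
proof -
  have "moment_form w t p q =
      (\<Sum>j\<le>degree p. \<Sum>i\<le>n. coeff p j * coeff q i * moment w (t + 2 * int i - int j))"
    unfolding moment_form_def using assms
    by (intro sum.cong refl sum.mono_neutral_left) (auto simp: coeff_eq_0)
  also have "\<dots> = (\<Sum>j\<le>m. \<Sum>i\<le>n. coeff p j * coeff q i * moment w (t + 2 * int i - int j))"
    using assms by (intro sum.mono_neutral_left) (auto simp: coeff_eq_0)
  finally show ?thesis .
qed

lemma moment_form_add_left:
  "moment_form w t (p + p') q = moment_form w t p q + moment_form w t p' q"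
proof -
  let ?m = "max (degree p) (degree p')"
  note b = moment_form_bounds[where m = ?m and n = "degree q"]
  show ?thesis
    by (simp add: b degree_add_le sum.distrib algebra_simps)
qed

lemma moment_form_add_right:
  "moment_form w t p (q + q') = moment_form w t p q + moment_form w t p q'"
proof -
  let ?n = "max (degree q) (degree q')"
  note b = moment_form_bounds[where m = "degree p" and n = ?n]
  show ?thesis
    by (simp add: b degree_add_le sum.distrib algebra_simps)
qed

lemma moment_form_smult_left:
  "moment_form w t (Polynomial.smult a p) q = a * moment_form w t p q"
proof -
  note b = moment_form_bounds[where m = "degree p" and n = "degree q"]
  show ?thesis
    by (simp add: b degree_smult_le sum_distrib_left mult_ac)
qed

lemma moment_form_smult_right:
  "moment_form w t p (Polynomial.smult a q) = a * moment_form w t p q"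
proof -
  note b = moment_form_bounds[where m = "degree p" and n = "degree q"]
  show ?thesis
    by (simp add: b degree_smult_le sum_distrib_left mult_ac)
qed

lemma moment_form_diff_left:
  "moment_form w t (p - p') q = moment_form w t p q - moment_form w t p' q"
  using moment_form_add_left[of w t "p - p'" p' q] by simp

lemma moment_form_0_left [simp]: "moment_form w t 0 q = 0"
  by (simp add: moment_form_def)

lemma moment_form_0_right [simp]: "moment_form w t p 0 = 0"
  by (simp add: moment_form_def)

lemma moment_form_sum_left:
  "moment_form w t (\<Sum>k\<in>A. f k) q = (\<Sum>k\<in>A. moment_form w t (f k) q)"
  by (induction A rule: infinite_finite_induct) (simp_all add: moment_form_add_left)

lemma moment_form_sum_right:
  "moment_form w t p (\<Sum>k\<in>A. f k) = (\<Sum>k\<in>A. moment_form w t p (f k))"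
  by (induction A rule: infinite_finite_induct) (simp_all add: moment_form_add_right)

text \<open>
  A factor \<open>z\<close> on the right raises the moment index \<open>t + 2i - j\<close> by 2, a factor \<open>z\<^sup>2\<close> on the left
  lowers it by 2, and either is undone by a change of offset.
\<close>

lemma moment_form_shift_right:
  "moment_form w t p (pCons 0 q) = moment_form w (t + 2) p q"
proof -
  have "moment_form w t p (pCons 0 q) = (\<Sum>j\<le>degree p. \<Sum>i\<le>Suc (degree q).
      coeff p j * coeff (pCons 0 q) i * moment w (t + 2 * int i - int j))"
    by (rule moment_form_bounds) (simp_all add: degree_pCons_le)
  also have "\<dots> = moment_form w (t + 2) p q"
    unfolding moment_form_def sum.atMost_Suc_shift by (simp add: algebra_simps)
  finally show ?thesis .
qed

lemma moment_form_shift_left: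
  "moment_form w (t + 2) (pCons 0 (pCons 0 p)) q = moment_form w t p q"
proof -
  have "degree (pCons 0 (pCons 0 p)) \<le> Suc (Suc (degree p))"
    using degree_pCons_le[of 0 p] degree_pCons_le[of 0 "pCons 0 p"] by linarith
  then have "moment_form w (t + 2) (pCons 0 (pCons 0 p)) q =
      (\<Sum>j\<le>Suc (Suc (degree p)). \<Sum>i\<le>degree q.
        coeff (pCons 0 (pCons 0 p)) j * coeff q i * moment w (t + 2 + 2 * int i - int j))"
    by (rule moment_form_bounds) simp
  also have "\<dots> = moment_form w t p q"
    unfolding moment_form_def sum.atMost_Suc_shift by (simp add: algebra_simps)
  finally show ?thesis .
qed

section \<open>Biorthogonal families as bases\<close>

lemma biorthogonal_upto_monic:
  assumes "biorthogonal_upto w t N P Q" "k \<le> N"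
  shows "degree (P k) = k" "coeff (P k) k = 1" "degree (Q k) = k" "coeff (Q k) k = 1"
  using assms unfolding biorthogonal_upto_def by metis+

lemma biorthogonal_upto_moment_form:
  assumes "circle_weight w" "biorthogonal_upto w t N P Q" "k \<le> N" "l \<le> N"
  shows "moment_form w t (P k) (Q l) = (if k = l then norm_const w t k else 0)"
proof -
  have "moment_form w t (P k) (Q l) = circle_integral
      (\<lambda>\<zeta>. poly (P k) \<zeta> * poly (Q l) (\<zeta> powi (- 2)) * \<zeta> powi (- t) * w \<zeta>)"
    unfolding moment_form_def using assms(1) by (subst circle_integral_poly) auto
  also have "\<dots> = (if k = l then norm_const w t k else 0)"
    using assms unfolding biorthogonal_upto_def by blast
  finally show ?thesis .
qed

text \<open>
  The top coefficient is recorded because pairing with the dual family recovers only coefficients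
  whose norm is nonzero, and the norm of index \<open>n + 2\<close> below may vanish.
\<close>

lemma expand_in_monic_family:
  fixes R :: "nat \<Rightarrow> 'a::comm_ring_1 poly"
  assumes "\<And>k. k \<le> N \<Longrightarrow> degree (R k) = k" "\<And>k. k \<le> N \<Longrightarrow> coeff (R k) k = 1"
    and "degree p \<le> N"
  shows "\<exists>c. p = (\<Sum>k\<le>N. Polynomial.smult (c k) (R k)) \<and> c N = coeff p N"
  using assms
proof (induction N arbitrary: p)
  case 0
  have "R 0 = [:1:]"
    using 0(1,2)[of 0] degree_0_id[of "R 0"] by simp
  moreover have "p = [:coeff p 0:]"
    using 0(3) degree_0_id[of p] by simp
  ultimately have "p = (\<Sum>k\<le>0. Polynomial.smult (coeff p 0) (R k))"
    by simp
  then show ?case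
    by (intro exI[of _ "\<lambda>_. coeff p 0"]) (rule conjI, assumption, rule refl)
next
  case (Suc N)
  let ?p = "p - Polynomial.smult (coeff p (Suc N)) (R (Suc N))"
  have R: "degree (R (Suc N)) = Suc N" "coeff (R (Suc N)) (Suc N) = 1"
    using Suc.prems(1,2)[of "Suc N"] by simp_all
  have "degree ?p \<le> N"
  proof (rule degree_le, intro allI impI)
    fix i assume "N < i"
    then consider "i = Suc N" | "i > Suc N" by linarith
    then show "coeff ?p i = 0"
      using R Suc.prems(3) by cases (simp_all add: coeff_eq_0)
  qed
  then obtain c where c: "?p = (\<Sum>k\<le>N. Polynomial.smult (c k) (R k))"
    using Suc.IH[of ?p] Suc.prems(1,2) by force
  let ?c = "c(Suc N := coeff p (Suc N))"
  have "p = ?p + Polynomial.smult (coeff p (Suc N)) (R (Suc N))"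
    by simp
  also have "\<dots> = (\<Sum>k\<le>Suc N. Polynomial.smult (?c k) (R k))"
    unfolding c by simp
  finally show ?case
    by (intro exI[of _ ?c]) (rule conjI, assumption, simp)
qed

section \<open>The kernel as a polynomial in its second argument\<close>

definition kernel_section ::
  "(complex \<Rightarrow> complex) \<Rightarrow> int \<Rightarrow> (nat \<Rightarrow> complex poly) \<Rightarrow> (nat \<Rightarrow> complex poly) \<Rightarrow>
   nat \<Rightarrow> complex \<Rightarrow> complex poly"
  where
  "kernel_section w t P Q n y = (\<Sum>j\<le>n. Polynomial.smult (poly (Q j) y / norm_const w t j) (P j))"

lemma poly_kernel_section:
  "poly (kernel_section w t P Q n y) x = reproducing_kernel w t P Q n y x"
  by (simp add: kernel_section_def reproducing_kernel_def poly_sum atLeast0AtMost)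

lemma degree_kernel_section:
  assumes "biorthogonal_upto w t N P Q" "n \<le> N"
  shows "degree (kernel_section w t P Q n y) \<le> n"
  unfolding kernel_section_def
proof (rule degree_sum_le)
  fix j assume "j \<in> {..n}"
  then show "degree (Polynomial.smult (poly (Q j) y / norm_const w t j) (P j)) \<le> n"
    using biorthogonal_upto_monic(1)[OF assms(1), of j] assms(2)
    by (auto intro: order_trans[OF degree_smult_le])
qed simp

lemma coeff_kernel_section:
  assumes "biorthogonal_upto w t N P Q" "n \<le> N"
  shows "coeff (kernel_section w t P Q n y) n = poly (Q n) y / norm_const w t n"
proof -
  have "coeff (kernel_section w t P Q n y) n =
      (\<Sum>j\<le>n. if j = n then poly (Q n) y / norm_const w t n else 0)"
    unfolding kernel_section_def coeff_sum
    by (rule sum.cong)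
      (use biorthogonal_upto_monic(1,2)[OF assms(1)] assms(2) in \<open>auto simp: coeff_eq_0\<close>)
  then show ?thesis
    by simp
qed

text \<open>
  By duality, pairing with \<open>Q\<^sub>l\<close> extracts the \<open>l\<close>-th summand of the kernel. The case \<open>l > n\<close> is what
  allows the kernel to be paired with polynomials of degree larger than \<open>n\<close>.
\<close>

lemma moment_form_kernel_section:
  assumes "circle_weight w" "biorthogonal_upto w t N P Q" "n \<le> N" "l \<le> N"
    and "\<And>j. j \<le> n \<Longrightarrow> norm_const w t j \<noteq> 0"
  shows "moment_form w t (kernel_section w t P Q n y) (Q l) = (if l \<le> n then poly (Q l) y else 0)"
proof -
  have "moment_form w t (kernel_section w t P Q n y) (Q l) =
      (\<Sum>j\<le>n. if j = l then poly (Q l) y else 0)"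
    unfolding kernel_section_def moment_form_sum_left moment_form_smult_left
    by (rule sum.cong)
      (use assms in \<open>auto simp: biorthogonal_upto_moment_form[OF assms(1,2)]\<close>)
  then show ?thesis
    by simp
qed

lemma kernel_section_reproduces:
  assumes "circle_weight w" "biorthogonal_upto w t N P Q" "n \<le> N" "degree q \<le> n"
    and "\<And>j. j \<le> n \<Longrightarrow> norm_const w t j \<noteq> 0"
  shows "moment_form w t (kernel_section w t P Q n y) q = poly q y"
proof -
  obtain c where c: "q = (\<Sum>l\<le>n. Polynomial.smult (c l) (Q l))"
    using expand_in_monic_family[of n Q q] assms(3,4) biorthogonal_upto_monic(3,4)[OF assms(2)]
    by auto
  have "moment_form w t (kernel_section w t P Q n y) q = (\<Sum>l\<le>n. c l * poly (Q l) y)"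
    unfolding c moment_form_sum_right moment_form_smult_right
    by (rule sum.cong) (use assms(3) moment_form_kernel_section[OF assms(1,2,3) _ assms(5)] in auto)
  then show ?thesis
    by (simp add: c poly_sum)
qed

section \<open>The Christoffel-Darboux identity\<close>

theorem proposition1:
  fixes w :: "complex \<Rightarrow> complex" and n :: nat and r :: int
    and P Q :: "int \<Rightarrow> nat \<Rightarrow> complex poly"
    and z1 z2 :: complex
  assumes "circle_weight w"
    and "\<And>t k. t \<in> {r, r + 2} \<Longrightarrow> k \<le> n + 2 \<Longrightarrow> moment_det w t k \<noteq> 0"
    and "\<And>t. t \<in> {r, r + 2} \<Longrightarrow> biorthogonal_upto w t (n + 2) (P t) (Q t)"
    and "z2 * z1\<^sup>2 \<noteq> 1"
  shows "reproducing_kernel w r (P r) (Q r) n z2 z1 =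
    1 / (z2 * z1\<^sup>2 - 1) *
      (1 / norm_const w (r + 2) n * poly (P (r + 2) n) z1 * poly (Q r (n + 1)) z2
       + 1 / norm_const w r n * z2 * poly (P (r + 2) (n + 2)) z1 * poly (Q r n) z2
       + 1 / norm_const w (r + 2) (n + 1) * poly (P (r + 2) (n + 1)) z1 *
           (poly (Q r (n + 2)) z2
            - (z2 + subcoeff (Q r (n + 2)) 1 - subcoeff (Q (r + 2) (n + 1)) 1)
              * poly (Q r (n + 1)) z2))"
proof -
  let ?h = "norm_const w"
  note cw = assms(1)
  have br: "biorthogonal_upto w r (n + 2) (P r) (Q r)"
    and bs: "biorthogonal_upto w (r + 2) (n + 2) (P (r + 2)) (Q (r + 2))"
    using assms(3) by auto
  have h: "?h t k \<noteq> 0" if "t \<in> {r, r + 2}" "k \<le> n + 1" for t k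
    using assms(2)[of t k] assms(2)[of t "Suc k"] that by (simp add: norm_const_def)
  note monic_r = biorthogonal_upto_monic[OF br] and monic_s = biorthogonal_upto_monic[OF bs]

  define K where "K = kernel_section w r (P r) (Q r) n z2"
  have K_deg: "degree K \<le> n" and K_lead: "coeff K n = poly (Q r n) z2 / ?h r n"
    unfolding K_def using degree_kernel_section[OF br] coeff_kernel_section[OF br] by auto
  have K_eval: "moment_form w r K q = poly q z2" if "degree q \<le> n" for q
    unfolding K_def by (rule kernel_section_reproduces[OF cw br]) (use that h in auto)
  have K_zero: "moment_form w r K (Q r l) = 0" if "n < l" "l \<le> n + 2" for l
    unfolding K_def using moment_form_kernel_section[OF cw br, of n l z2] that h by auto
  have K_mod: "moment_form w r K (q + Polynomial.smult a (Q r (n + 1))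
      + Polynomial.smult b (Q r (n + 2))) = poly q z2" if "degree q \<le> n" for q a b
    by (simp add: moment_form_add_right moment_form_smult_right K_eval[OF that] K_zero)

  (* The expansion of F in the polynomials P (r + 2) k turns out to be the right-hand side of the
     identity, multiplied by z2 * z1^2 - 1. *)
  define F where "F = Polynomial.smult z2 (pCons 0 (pCons 0 K)) - K"
  have F_poly: "poly F z1 = (z2 * z1\<^sup>2 - 1) * reproducing_kernel w r (P r) (Q r) n z2 z1"
    by (simp add: F_def K_def poly_kernel_section power2_eq_square algebra_simps)
  have F_deg: "degree F \<le> n + 2"
    by (rule degree_le) (use K_deg in \<open>auto simp: F_def coeff_pCons coeff_eq_0 split: nat.splits\<close>)
  have F_lead: "coeff F (n + 2) = z2 * poly (Q r n) z2 / ?h r n"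
    using K_deg by (simp add: F_def K_lead coeff_eq_0)
  have F_form: "moment_form w (r + 2) F q =
      z2 * moment_form w r K q - moment_form w r K (pCons 0 q)" for q
    by (simp add: F_def moment_form_diff_left moment_form_smult_left moment_form_shift_left
        moment_form_shift_right)

  obtain c where c: "F = (\<Sum>k\<le>n + 2. Polynomial.smult (c k) (P (r + 2) k))"
    and c_top: "c (n + 2) = coeff F (n + 2)"
    using expand_in_monic_family[of "n + 2" "P (r + 2)" F] monic_s(1,2) F_deg by blast
  have c_form: "c k * ?h (r + 2) k = moment_form w (r + 2) F (Q (r + 2) k)" if "k \<le> n + 2" for k
  proof -
    have "moment_form w (r + 2) F (Q (r + 2) k) =
        (\<Sum>j\<le>n + 2. if j = k then c k * ?h (r + 2) k else 0)"
      unfolding c moment_form_sum_left moment_form_smult_left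
      by (rule sum.cong) (use that biorthogonal_upto_moment_form[OF cw bs] in auto)
    with that show ?thesis
      by simp
  qed

  have c_low: "c k = 0" if "k < n" for k
  proof -
    have deg: "degree (Q (r + 2) k) = k"
      using monic_s(3) that by simp
    have "degree (pCons 0 (Q (r + 2) k)) \<le> n"
      using degree_pCons_le[of 0 "Q (r + 2) k"] deg that by simp
    then have "c k * ?h (r + 2) k = 0"
      using that deg by (subst c_form) (simp_all add: F_form K_eval)
    then show ?thesis
      using h[of "r + 2" k] that by simp
  qed

  have c_n: "c n = poly (Q r (n + 1)) z2 / ?h (r + 2) n"
  proof -
    let ?q = "pCons 0 (Q (r + 2) n) - Q r (n + 1)"
    have "degree ?q \<le> n"
    proof (rule degree_le, intro allI impI)
      fix i assume "n < i"
      then show "coeff ?q i = 0"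
        using monic_r(3,4)[of "n + 1"] monic_s(3,4)[of n]
        by (cases "i = n + 1") (auto simp: coeff_pCons coeff_eq_0 split: nat.splits)
    qed
    then have "moment_form w r K (pCons 0 (Q (r + 2) n)) = poly ?q z2"
      using K_mod[of ?q 1 0] by simp
    moreover have "moment_form w r K (Q (r + 2) n) = poly (Q (r + 2) n) z2"
      using K_eval monic_s(3)[of n] by simp
    ultimately have "c n * ?h (r + 2) n = poly (Q r (n + 1)) z2"
      using c_form[of n] by (simp add: F_form)
    then show ?thesis
      using h[of "r + 2" n] by (simp add: field_simps)
  qed

  let ?d = "subcoeff (Q r (n + 2)) 1 - subcoeff (Q (r + 2) (n + 1)) 1"
  let ?B = "poly (Q r (n + 2)) z2 - (z2 + ?d) * poly (Q r (n + 1)) z2"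
  have c_n1: "c (n + 1) = ?B / ?h (r + 2) (n + 1)"
  proof -
    let ?q1 = "Q (r + 2) (n + 1) - Q r (n + 1)"
    (* After the leading terms cancel, the coefficient of degree n + 1 is the difference of two
       subleading coefficients; adding ?d times Q r (n + 1) removes it. *)
    let ?q2 = "pCons 0 (Q (r + 2) (n + 1)) - Q r (n + 2) + Polynomial.smult ?d (Q r (n + 1))"
    have d: "?d = coeff (Q r (n + 2)) (n + 1) - coeff (Q (r + 2) (n + 1)) n"
      using monic_r(3)[of "n + 2"] monic_s(3)[of "n + 1"] by (simp add: subcoeff_def)
    have "degree ?q1 \<le> n"
    proof (rule degree_le, intro allI impI)
      fix i assume "n < i"
      then show "coeff ?q1 i = 0"
        using monic_r(3,4)[of "n + 1"] monic_s(3,4)[of "n + 1"]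
        by (cases "i = n + 1") (auto simp: coeff_eq_0)
    qed
    then have 1: "moment_form w r K (Q (r + 2) (n + 1)) = poly ?q1 z2"
      using K_mod[of ?q1 1 0] by simp
    have "degree ?q2 \<le> n"
    proof (rule degree_le, intro allI impI)
      fix i assume "n < i"
      then consider "i = n + 1" | "i = n + 2" | "i > n + 2" by linarith
      then show "coeff ?q2 i = 0"
        unfolding d
        using monic_r(3,4)[of "n + 1"] monic_r(3,4)[of "n + 2"] monic_s(3,4)[of "n + 1"]
        by cases (auto simp: coeff_pCons coeff_eq_0 split: nat.splits)
    qed
    then have 2: "moment_form w r K (pCons 0 (Q (r + 2) (n + 1))) = poly ?q2 z2"
      using K_mod[of ?q2 "- ?d" 1]
      by (simp only: smult_minus_left smult_1_left diff_add_cancel add_uminus_conv_diff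
          add_diff_cancel_right')
    have "c (n + 1) * ?h (r + 2) (n + 1) = z2 * poly ?q1 z2 - poly ?q2 z2"
      using c_form[of "n + 1"] 1 2 by (simp only: F_form)
    also have "\<dots> = ?B"
      by (simp add: algebra_simps)
    finally show ?thesis
      using h[of "r + 2" "n + 1"] by (simp add: field_simps)
  qed

  have "poly F z1 = (\<Sum>k\<le>n + 2. c k * poly (P (r + 2) k) z1)"
    by (simp add: c poly_sum)
  also have "\<dots> = (\<Sum>k\<in>{n, n + 1, n + 2}. c k * poly (P (r + 2) k) z1)"
    by (rule sum.mono_neutral_right) (auto simp: c_low)
  also have "\<dots> = 1 / ?h (r + 2) n * poly (P (r + 2) n) z1 * poly (Q r (n + 1)) z2
       + 1 / ?h r n * z2 * poly (P (r + 2) (n + 2)) z1 * poly (Q r n) z2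
       + 1 / ?h (r + 2) (n + 1) * poly (P (r + 2) (n + 1)) z1 *
         (poly (Q r (n + 2)) z2
          - (z2 + subcoeff (Q r (n + 2)) 1 - subcoeff (Q (r + 2) (n + 1)) 1)
            * poly (Q r (n + 1)) z2)" (is "_ = ?R")
    using c_n c_n1 c_top F_lead by (simp add: mult_ac add_diff_eq)
  finally have "(z2 * z1\<^sup>2 - 1) * reproducing_kernel w r (P r) (Q r) n z2 z1 = ?R"
    by (simp only: F_poly)
  moreover have "z2 * z1\<^sup>2 - 1 \<noteq> 0"
    using assms(4) by simp
  ultimately show ?thesis
    by (metis nonzero_mult_div_cancel_left times_divide_eq_left mult_1)
qed

end
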